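(* Let $I,J\in\mathbb{N}$, $C=(c^{ij})\in\mathbb{R}^{I\times J}$, $x\in\mathcal{P}_I$, $y\in\mathcal{P}_J$. Assume: (i) $\Pi(x,y)\neq\operatorname*{argmin}_{\Pi\in\Pi(x,y)}\langle C,\Pi\rangle$; (ii) $U\in C([0,1])\cap C^1((0,1])\cap C^2((0,1))$ satisfies $U''>0$ on $(0,1)$, $\lim_{h\downarrow 0}U'(h)=-\infty$, and $r\mapsto rU''(r)$ is non-decreasing on $(0,1)$. Then the interval \[ \left(0,\frac{\Delta_C(x,y)\,R_U(x,y)}{\mathfrak{D}_U(x,y)}\right]\cap\left(0,\frac{\Delta_C(x,y)}{\mathfrak{D}_U(x,y)+\nu_U(x,y)-U'(1)}\right] \] is well-defined and nonempty, and for every $\varepsilon$ in this interval, \[ \langle C,\Pi^U(C,x,y,\varepsilon)\rangle-\inf_{\Pi\in\Pi(x,y)}\langle C,\Pi\rangle\le \Delta_C(x,y)\cdot e_U\!\left(-\frac{\Delta_C(x,y)}{\varepsilon}+\mathfrak{D}_U(x,y)+\nu_U(x,y)\right). \]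
   Context: For $K\in\mathbb{N}$, $\mathcal{P}_K=\{z\in\mathbb{R}^K: z_k\ge 0,\ \sum_k z_k=1\}$. For $x\in\mathcal{P}_I,y\in\mathcal{P}_J$, $(x\otimes y)_{ij}=x_iy_j$, and $\Pi(x,y)$ is the set of $\Pi=(\pi_{ij})\in\mathcal{P}_{I\times J}$ (viewed in $\mathbb{R}^{I\times J}$) with $\sum_{l}\pi_{il}=x_i$ and $\sum_l \pi_{lj}=y_j$ for all $i,j$; it is a convex polytope, and $V(x,y)$ denotes its set of vertices. $\langle C,\Pi\rangle=\sum_{i,j}c^{ij}\pi_{ij}$. For $U$ continuous strictly convex on $[0,1]$ and $C^1$ on $(0,1]$: $d_U(r,r_0)=U(r)-U(r_0)-(r-r_0)U'(r_0)$ for $r\in[0,1]$, $r_0\in(0,1]$, extended by $d_U(r,0)=\lim_{r_0\downarrow0}d_U(r,r_0)\in[0,\infty]$; $D_U(z,w)=\sum_k d_U(z_k,w_k)$ for $z,w\in\mathcal{P}_K$. For $\varepsilon>0$, $\Pi^U(C,x,y,\varepsilon)$ is the unique minimizer over $\Pi(x,y)$ of $\langle C,\Pi\rangle+\varepsilon D_U(\Pi,x\otimes y)$. $\mathfrak{D}_U(x,y)=\sup_{\Pi\in\Pi(x,y)}D_U(\Pi,x\otimes y)$. $\Delta_C(x,y)=\inf_{V'\in V(x,y)\setminus\operatorname*{argmin}_{V\in V(x,y)}\langle C,V\rangle}\langle C,V'\rangle-\inf_{V\in V(x,y)}\langle C,V\rangle$ (with $\inf\emptyset=\infty$). Under (ii):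 $e_U$ is the inverse function of $U':(0,1]\to U'((0,1])$; $R_U(x,y)\in[1/2,1)$ is the unique number with $U'(R_U(x,y))-U'(1-R_U(x,y))=\mathfrak{D}_U(x,y)$; and $\nu_U(x,y)=\sup_{r\in(0,R_U(x,y)]}\big(U'(1-r)+rU''(r)\big)$. *)

theory Defs
  imports "HOL-Analysis.Analysis"
begin

definition prob_simplex :: "(real ^ 'k::finite) set" where
  "prob_simplex = {z. (\<forall>k. 0 \<le> z $ k) \<and> (\<Sum>k\<in>UNIV. z $ k) = 1}"

definition tensor :: "real ^ 'i::finite \<Rightarrow> real ^ 'j::finite \<Rightarrow> real ^ 'j ^ 'i" where
  "tensor x y = (\<chi> i j. x $ i * y $ j)"

definition couplings :: "real ^ 'i::finite \<Rightarrow> real ^ 'j::finite \<Rightarrow> (real ^ 'j ^ 'i) set" where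
  "couplings x y = {P. (\<forall>i j. 0 \<le> P $ i $ j) \<and> (\<Sum>i\<in>UNIV. \<Sum>j\<in>UNIV. P $ i $ j) = 1
       \<and> (\<forall>i. (\<Sum>j\<in>UNIV. P $ i $ j) = x $ i) \<and> (\<forall>j. (\<Sum>i\<in>UNIV. P $ i $ j) = y $ j)}"

definition vertices :: "real ^ 'i::finite \<Rightarrow> real ^ 'j::finite \<Rightarrow> (real ^ 'j ^ 'i) set" where
  "vertices x y = {V. V extreme_point_of couplings x y}"

definition pairing :: "real ^ 'j::finite ^ 'i::finite \<Rightarrow> real ^ 'j ^ 'i \<Rightarrow> real" where
  "pairing C P = (\<Sum>i\<in>UNIV. \<Sum>j\<in>UNIV. C $ i $ j * P $ i $ j)"

text \<open>Bregman-type divergence d_U; U' is the derivative of U on (0,1].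
  The value at r0 = 0 is the limit from the right, in [0,\<infinity>].\<close>
definition dU :: "(real \<Rightarrow> real) \<Rightarrow> (real \<Rightarrow> real) \<Rightarrow> real \<Rightarrow> real \<Rightarrow> ereal" where
  "dU U U' r r0 = (if 0 < r0 then ereal (U r - U r0 - (r - r0) * U' r0)
     else Lim (at_right 0) (\<lambda>s. ereal (U r - U s - (r - s) * U' s)))"

definition DU :: "(real \<Rightarrow> real) \<Rightarrow> (real \<Rightarrow> real) \<Rightarrow> real ^ 'j::finite ^ 'i::finite \<Rightarrow> real ^ 'j ^ 'i \<Rightarrow> ereal" where
  "DU U U' z w = (\<Sum>i\<in>UNIV. \<Sum>j\<in>UNIV. dU U U' (z $ i $ j) (w $ i $ j))"

definition PiU :: "(real \<Rightarrow> real) \<Rightarrow> (real \<Rightarrow> real) \<Rightarrow> real ^ 'j::finite ^ 'i::finite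
    \<Rightarrow> real ^ 'i \<Rightarrow> real ^ 'j \<Rightarrow> real \<Rightarrow> real ^ 'j ^ 'i" where
  "PiU U U' C x y eps = (THE P. P \<in> couplings x y \<and>
     (\<forall>Q\<in>couplings x y. ereal (pairing C P) + ereal eps * DU U U' P (tensor x y)
                         \<le> ereal (pairing C Q) + ereal eps * DU U U' Q (tensor x y)))"

definition frakD :: "(real \<Rightarrow> real) \<Rightarrow> (real \<Rightarrow> real) \<Rightarrow> real ^ 'i::finite \<Rightarrow> real ^ 'j::finite \<Rightarrow> ereal" where
  "frakD U U' x y = (SUP P\<in>couplings x y. DU U U' P (tensor x y))"

text \<open>Delta_C(x,y), with inf of the empty set = \<infinity>.\<close>
definition DeltaC :: "real ^ 'j::finite ^ 'i::finite \<Rightarrow> real ^ 'i \<Rightarrow> real ^ 'j \<Rightarrow> ereal" where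
  "DeltaC C x y =
     (let Vs = vertices x y;
          A = {V\<in>Vs. \<forall>W\<in>Vs. pairing C V \<le> pairing C W}
      in (INF V'\<in>Vs - A. ereal (pairing C V')) - (INF V\<in>Vs. ereal (pairing C V)))"

definition eU :: "(real \<Rightarrow> real) \<Rightarrow> real \<Rightarrow> real" where
  "eU U' t = (THE r. r \<in> {0<..1} \<and> U' r = t)"

definition RU :: "(real \<Rightarrow> real) \<Rightarrow> (real \<Rightarrow> real) \<Rightarrow> real ^ 'i::finite \<Rightarrow> real ^ 'j::finite \<Rightarrow> real" where
  "RU U U' x y = (THE R. 1/2 \<le> R \<and> R < 1 \<and> ereal (U' R - U' (1 - R)) = frakD U U' x y)"

definition nuU :: "(real \<Rightarrow> real) \<Rightarrow> (real \<Rightarrow> real) \<Rightarrow> (real \<Rightarrow> real) \<Rightarrow> real ^ 'i::finite \<Rightarrow> real ^ 'j::finite \<Rightarrow> real" where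
  "nuU U U' U'' x y = (SUP r\<in>{0<..RU U U' x y}. U' (1 - r) + r * U'' r)"

end

(*
  Let m be the minimal cost, P the regularized minimizer and r = (<C,P> - m) / Delta.  Splitting
  the vertices into optimal and non-optimal ones gives P = (1 - r) A + r B with A an optimal
  coupling and B a coupling.  Entrywise, the Jensen gap of U at (a, b) is at most the sum of those
  at (a, 0) and (0, b), since U(s) + U(t) <= U(0) + U(s + t), and these are at most a resp. b
  times the gaps at (1, 0) and (0, 1), since r U''(r) is monotone.  Summing over the entries,
    D(A) - D(P) <= r (D(A) - D(B)) + U(0) + U(1) - U(r) - U(1 - r) <= r (frakD + nu - U'(r)).
  Minimality of P against A gives r Delta <= eps (D(A) - D(P)), hence
  U'(r) <= frakD + nu - Delta / eps.
*)

theory Submission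
  imports Defs
begin

section \<open>Generators of Bregman divergences\<close>

lemma mean_value_real_derivative:
  fixes f :: "real \<Rightarrow> real"
  assumes "a < b" "continuous_on {a..b} f"
    and "\<And>s. a < s \<Longrightarrow> s < b \<Longrightarrow> (f has_real_derivative f' s) (at s)"
  obtains \<xi> where "a < \<xi>" "\<xi> < b" "f b - f a = (b - a) * f' \<xi>"
proof (rule mvt[OF assms(1,2)])
  show "(f has_derivative (*) (f' s)) (at s)" if "a < s" "s < b" for s
    using assms(3)[OF that] by (simp add: has_field_derivative_def)
qed (use that in \<open>simp add: mult.commute\<close>)

text \<open>\<open>U'\<close> and \<open>U''\<close> are explicit functions tied to \<open>U\<close>
  by derivative facts. At 1 the derivative within \<open>{0..1}\<close> is the left one; at 0 the
  slope is -\<infinity>, so statements there are reached through continuity of \<open>U\<close> or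
  limits.\<close>

locale bregman_generator =
  fixes U U' U'' :: "real \<Rightarrow> real"
  assumes U_cont: "continuous_on {0..1} U"
    and U_deriv: "\<And>r. r \<in> {0<..1} \<Longrightarrow> (U has_real_derivative U' r) (at r within {0..1})"
    and U'_cont: "continuous_on {0<..1} U'"
    and U'_deriv: "\<And>r. r \<in> {0<..<1} \<Longrightarrow> (U' has_real_derivative U'' r) (at r)"
    and U''_pos: "\<And>r. r \<in> {0<..<1} \<Longrightarrow> 0 < U'' r"
    and U'_lim: "filterlim U' at_bot (at_right 0)"
    and mono: "mono_on {0<..<1} (\<lambda>r. r * U'' r)"
begin

section \<open>Monotonicity of \<open>U'\<close> and convexity of \<open>U\<close>\<close>

lemma U_deriv_interior: "0 < r \<Longrightarrow> r < 1 \<Longrightarrow> (U has_real_derivative U' r) (at r)"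
  using U_deriv[of r] at_within_interior[of r "{0..1}"] by simp

lemma U_cont_subset: "0 \<le> a \<Longrightarrow> b \<le> 1 \<Longrightarrow> continuous_on {a..b} U"
  using continuous_on_subset[OF U_cont, of "{a..b}"] by auto

lemma U'_strict_mono:
  assumes "0 < r" "r < s" "s \<le> 1"
  shows "U' r < U' s"
proof (rule DERIV_pos_imp_increasing_open[OF assms(2)])
  show "\<exists>y. DERIV U' t :> y \<and> 0 < y" if "r < t" "t < s" for t
    using U'_deriv[of t] U''_pos[of t] that assms by auto
  show "continuous_on {r..s} U'"
    by (rule continuous_on_subset[OF U'_cont]) (use assms in auto)
qed

lemma U'_mono: "0 < r \<Longrightarrow> r \<le> s \<Longrightarrow> s \<le> 1 \<Longrightarrow> U' r \<le> U' s"
  using U'_strict_mono[of r s] by (cases "r = s") auto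

lemma U'_le_iff: "0 < r \<Longrightarrow> r \<le> 1 \<Longrightarrow> 0 < s \<Longrightarrow> s \<le> 1 \<Longrightarrow> U' r \<le> U' s \<longleftrightarrow> r \<le> s"
  using U'_strict_mono[of s r] U'_mono[of r s] by (meson leD leI)

text \<open>The left end may be 0, where \<open>U\<close> has no derivative: the mean value theorem
  asks only for continuity at the ends.\<close>

lemma U_mean_value:
  assumes "0 \<le> a" "a < b" "b \<le> 1"
  obtains \<xi> where "a < \<xi>" "\<xi> < b" "U b - U a = (b - a) * U' \<xi>"
proof (rule mean_value_real_derivative[OF assms(2) U_cont_subset[OF assms(1,3)]])
  show "(U has_real_derivative U' s) (at s)" if "a < s" "s < b" for s
    using assms that by (intro U_deriv_interior) auto
qed

text \<open>The slope of the chord between \<open>p\<close> and \<open>w\<close> is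
  \<open>U'\<close> at an intermediate point, which strict monotonicity puts on the right side of
  \<open>U' w\<close>.\<close>

lemma U_tangent_strict:
  assumes "0 < w" "w \<le> 1" "0 \<le> p" "p \<le> 1" "p \<noteq> w"
  shows "0 < U p - U w - (p - w) * U' w"
proof (cases "p < w")
  case True
  then obtain \<xi> where "p < \<xi>" "\<xi> < w" "U w - U p = (w - p) * U' \<xi>"
    using U_mean_value[of p w] assms by auto
  moreover have "(w - p) * U' \<xi> < (w - p) * U' w"
    using U'_strict_mono[of \<xi> w] calculation assms True by auto
  ultimately show ?thesis by (simp add: algebra_simps)
next
  case False
  then obtain \<xi> where "w < \<xi>" "\<xi> < p" "U p - U w = (p - w) * U' \<xi>"
    using U_mean_value[of w p] assms by auto
  moreover have "(p - w) * U' w < (p - w) * U' \<xi>"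
    using U'_strict_mono[of w \<xi>] calculation assms False by auto
  ultimately show ?thesis by (simp add: algebra_simps)
qed

lemma U_tangent:
  assumes "0 < w" "w \<le> 1" "0 \<le> p" "p \<le> 1"
  shows "0 \<le> U p - U w - (p - w) * U' w"
  using U_tangent_strict[OF assms] by (cases "p = w") auto

text \<open>Add the strict tangent inequalities at the intermediate point, weighted by
  \<open>1 - t\<close> and \<open>t\<close>; the slope terms cancel.\<close>

lemma U_strict_convex:
  assumes "0 \<le> a" "a \<le> 1" "0 \<le> b" "b \<le> 1" "a \<noteq> b" "0 < t" "t < 1"
  shows "U ((1 - t) * a + t * b) < (1 - t) * U a + t * U b"
proof -
  define p where "p = (1 - t) * a + t * b"
  \<comment> \<open>Tangents exist only off 0, so \<open>p\<close> must be positive even if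
    \<open>a\<close> or \<open>b\<close> is 0.\<close>
  have "0 < p"
  proof (cases "a = 0")
    case True then show ?thesis using assms by (simp add: p_def)
  next
    case False then have "0 < (1 - t) * a" "0 \<le> t * b" using assms by auto
    then show ?thesis by (simp add: p_def)
  qed
  have "p \<le> 1" unfolding p_def using assms convex_bound_le[of a 1 b "1 - t" t] by simp
  have ap: "a - p = t * (a - b)" and bp: "b - p = (1 - t) * (b - a)"
    by (auto simp: p_def algebra_simps)
  then have "a \<noteq> p" "b \<noteq> p" using assms by auto
  then have "0 < (1 - t) * (U a - U p - (a - p) * U' p)" "0 < t * (U b - U p - (b - p) * U' p)"
    using U_tangent_strict[of p a] U_tangent_strict[of p b] \<open>0 < p\<close> \<open>p \<le> 1\<close> assms by auto
  then have "0 < (1 - t) * (U a - U p - (a - p) * U' p) + t * (U b - U p - (b - p) * U' p)"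
    by simp
  also have "\<dots> = (1 - t) * U a + t * U b - U p"
    unfolding ap bp by (simp add: algebra_simps)
  finally show ?thesis by (simp add: p_def)
qed

lemma U_convex:
  assumes "0 \<le> a" "a \<le> 1" "0 \<le> b" "b \<le> 1" "0 \<le> t" "t \<le> 1"
  shows "U ((1 - t) * a + t * b) \<le> (1 - t) * U a + t * U b"
proof (cases "a = b \<or> t = 0 \<or> t = 1")
  case True
  then show ?thesis by (auto simp: algebra_simps)
next
  case False
  then show ?thesis using U_strict_convex[of a b t] assms by auto
qed

section \<open>Jensen gaps of \<open>U\<close>\<close>

text \<open>\<open>s\<close> and \<open>t\<close> are mixtures of 0 and \<open>s + t\<close> with
  complementary weights, so the two chord bounds add up.\<close>

lemma U_add_le:
  assumes "0 \<le> s" "0 \<le> t" "s + t \<le> 1"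
  shows "U s + U t \<le> U 0 + U (s + t)"
proof (cases "s + t = 0")
  case True
  then have "s = 0" "t = 0" using assms by auto
  then show ?thesis by simp
next
  case False
  define q where "q = s / (s + t)"
  have q: "0 \<le> q" "q \<le> 1" "q * (s + t) = s" using False assms by (auto simp: q_def)
  have "U s \<le> (1 - q) * U 0 + q * U (s + t)"
    using U_convex[of 0 "s + t" q] q assms by simp
  moreover have "(1 - q) * (s + t) = t" using q by (simp add: algebra_simps)
  then have "U t \<le> q * U 0 + (1 - q) * U (s + t)"
    using U_convex[of 0 "s + t" "1 - q"] q assms by simp
  ultimately show ?thesis by (simp add: algebra_simps)
qed

text \<open>The monotonicity of \<open>r * U'' r\<close> makes \<open>s \<mapsto> q * U s - U (q * s)\<close> convex.\<close>

lemma U_scaling_gap: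
  assumes "0 \<le> q" "q \<le> 1" "0 \<le> a" "a \<le> 1"
  shows "q * U a + (1 - q) * U 0 - U (q * a) \<le> a * (q * U 1 + (1 - q) * U 0 - U q)"
proof (cases "q = 0 \<or> a = 0 \<or> a = 1")
  case True
  then show ?thesis by (auto simp: algebra_simps)
next
  case False
  then have qa: "0 < q" "0 < a" "a < 1" using assms by auto
  \<comment> \<open>The claim is equivalent to \<open>g a \<le> (1 - a) * g 0 + a * g 1\<close>, a
    convexity inequality for \<open>g\<close>.\<close>
  define g where "g = (\<lambda>s. q * U s - U (q * s))"
  define g' where "g' = (\<lambda>s. q * (U' s - U' (q * s)))"
  have q1: "0 < q * s" "q * s < 1" if "0 < s" "s < 1" for s
  proof -
    show "0 < q * s" using qa that by simp
    have "q * s \<le> 1 * s" using assms that by (intro mult_right_mono) auto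
    then show "q * s < 1" using that by linarith
  qed
  have dg: "(g has_real_derivative g' s) (at s)" if "0 < s" "s < 1" for s
  proof -
    have "((\<lambda>s. U (q * s)) has_real_derivative U' (q * s) * (q * 1)) (at s)"
      using q1[OF that] by (intro DERIV_chain2[where f=U] U_deriv_interior derivative_intros) auto
    then show ?thesis unfolding g_def g'_def using that
      by (auto intro!: derivative_eq_intros U_deriv_interior simp: algebra_simps)
  qed
  have dg': "(g' has_real_derivative q * (U'' s - q * U'' (q * s))) (at s)" if "0 < s" "s < 1" for s
  proof -
    have "((\<lambda>s. U' (q * s)) has_real_derivative U'' (q * s) * (q * 1)) (at s)"
      using q1[OF that] by (intro DERIV_chain2[where f=U'] U'_deriv derivative_intros) auto
    then show ?thesis unfolding g'_def using that
      by (auto intro!: derivative_eq_intros U'_deriv simp: algebra_simps)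
  qed
  have "0 \<le> q * (U'' s - q * U'' (q * s))" if "0 < s" "s < 1" for s
  proof -
    have "q * s \<le> s" using assms that by (simp add: mult_le_cancel_right1)
    \<comment> \<open>Dividing this by \<open>s\<close> gives
      \<open>q * U'' (q * s) \<le> U'' s\<close>, the sign of the second derivative of
      \<open>g\<close>.\<close>
    then have "(q * s) * U'' (q * s) \<le> s * U'' s"
      using mono_onD[OF mono, of "q * s" s] that q1[OF that] by auto
    then have "0 \<le> s * (U'' s - q * U'' (q * s))" by (simp add: algebra_simps)
    then show ?thesis using that qa by (simp add: zero_le_mult_iff)
  qed
  with dg' have dg'_nonneg: "\<exists>y. DERIV g' s :> y \<and> 0 \<le> y" if "0 < s" "s < 1" for s
    using that by blast
  have g'_mono: "g' \<xi> \<le> g' \<eta>" if "0 < \<xi>" "\<xi> \<le> \<eta>" "\<eta> < 1" for \<xi> \<eta>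
    using that dg'_nonneg by (intro DERIV_nonneg_imp_nondecreasing[OF that(2)]) auto
  have cont: "continuous_on {0..1} g"
    unfolding g_def using assms
    by (auto intro!: continuous_intros U_cont continuous_on_compose2[OF U_cont] mult_le_one)
  \<comment> \<open>Mean values on both sides of \<open>a\<close> compare the two chord slopes of
    \<open>g\<close> using only interior derivatives.\<close>
  obtain \<xi> where \<xi>: "0 < \<xi>" "\<xi> < a" "g a - g 0 = (a - 0) * g' \<xi>"
  proof (rule mean_value_real_derivative[of 0 a g g'])
    show "continuous_on {0..a} g" by (rule continuous_on_subset[OF cont]) (use qa in auto)
  qed (use qa dg in auto)
  obtain \<eta> where \<eta>: "a < \<eta>" "\<eta> < 1" "g 1 - g a = (1 - a) * g' \<eta>"
  proof (rule mean_value_real_derivative[of a 1 g g'])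
    show "continuous_on {a..1} g" by (rule continuous_on_subset[OF cont]) (use qa in auto)
  qed (use qa dg in auto)
  have "(1 - a) * (g a - g 0) = a * ((1 - a) * g' \<xi>)" using \<xi> by simp
  also have "\<dots> \<le> a * ((1 - a) * g' \<eta>)"
    using g'_mono[of \<xi> \<eta>] \<xi> \<eta> qa by (intro mult_left_mono) auto
  also have "\<dots> = a * (g 1 - g a)" using \<eta> by simp
  finally have "g a \<le> (1 - a) * g 0 + a * g 1" by (simp add: algebra_simps)
  then show ?thesis by (simp add: g_def algebra_simps)
qed

text \<open>\<open>U_add_le\<close> separates the mixture into \<open>(1 - r) * a\<close> and
  \<open>r * b\<close>, its \<open>U 0\<close> being shared as
  \<open>r * U 0 + (1 - r) * U 0\<close>; \<open>U_scaling_gap\<close> bounds each piece. The bound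
  is linear in \<open>a\<close> and \<open>b\<close>, so summing it over the entries of couplings
  involves only their total masses.\<close>

lemma U_jensen_gap:
  assumes "0 \<le> r" "r \<le> 1" "0 \<le> a" "a \<le> 1" "0 \<le> b" "b \<le> 1"
  shows "(1 - r) * U a + r * U b - U ((1 - r) * a + r * b)
    \<le> a * ((1 - r) * U 1 + r * U 0 - U (1 - r)) + b * (r * U 1 + (1 - r) * U 0 - U r)"
proof -
  have "(1 - r) * a + r * b \<le> 1" using convex_bound_le[of a 1 b "1 - r" r] assms by simp
  then have "U ((1 - r) * a) + U (r * b) \<le> U 0 + U ((1 - r) * a + r * b)"
    using assms by (intro U_add_le) auto
  moreover have "(1 - r) * U a + (1 - (1 - r)) * U 0 - U ((1 - r) * a)
      \<le> a * ((1 - r) * U 1 + (1 - (1 - r)) * U 0 - U (1 - r))"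
    using assms by (intro U_scaling_gap) auto
  moreover have "r * U b + (1 - r) * U 0 - U (r * b) \<le> b * (r * U 1 + (1 - r) * U 0 - U r)"
    using assms by (intro U_scaling_gap) auto
  ultimately show ?thesis by (simp add: algebra_simps)
qed

section \<open>Limits at 0\<close>

lemma U_tendsto_at_0: "(U \<longlongrightarrow> U 0) (at_right 0)"
proof -
  have "(U \<longlongrightarrow> U 0) (at 0 within {0..1})"
    using U_cont by (auto simp: continuous_on_def)
  then show ?thesis by (simp add: at_within_Icc_at_right)
qed

lemma U'_neg_near_0: "\<forall>\<^sub>F s in at_right 0. U' s \<le> 0"
  using U'_lim by (simp add: filterlim_at_bot)

text \<open>Squeezed from above by 0, as \<open>U'\<close> is negative near 0, and from below by
  \<open>U s - U 0\<close>, from the tangent at \<open>s\<close> evaluated at 0.\<close>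

lemma mult_U'_tendsto_0: "((\<lambda>s. s * U' s) \<longlongrightarrow> 0) (at_right 0)"
proof (rule tendsto_sandwich)
  show "\<forall>\<^sub>F s in at_right 0. U s - U 0 \<le> s * U' s"
    using eventually_at_right_real[OF zero_less_one]
  proof eventually_elim
    case (elim s)
    then show ?case using U_tangent[of s 0] by simp
  qed
  show "\<forall>\<^sub>F s in at_right 0. s * U' s \<le> 0"
    using eventually_at_right_real[OF zero_less_one] U'_neg_near_0
    by eventually_elim (simp add: mult_nonneg_nonpos)
  show "((\<lambda>s. U s - U 0) \<longlongrightarrow> 0) (at_right 0)"
    using tendsto_diff[OF U_tendsto_at_0 tendsto_const[of "U 0"]] by simp
qed simp

lemma dU_pos: "0 < w \<Longrightarrow> dU U U' p w = ereal (U p - U w - (p - w) * U' w)"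
  by (simp add: dU_def)

text \<open>The one value of the limit branch of \<open>dU\<close> that occurs for couplings; see
  \<open>tensor_entry\<close>.\<close>

lemma dU_0_0: "dU U U' 0 0 = 0"
proof -
  have "((\<lambda>s. U 0 - U s + s * U' s) \<longlongrightarrow> U 0 - U 0 + 0) (at_right 0)"
    by (intro tendsto_intros U_tendsto_at_0 mult_U'_tendsto_0)
  then have "((\<lambda>s. ereal (U 0 - U s - (0 - s) * U' s)) \<longlongrightarrow> ereal 0) (at_right 0)"
    by (simp add: tendsto_ereal)
  then show ?thesis unfolding dU_def by (auto intro!: tendsto_Lim simp: zero_ereal_def)
qed

text \<open>Here \<open>U' (1 - s) + s * U'' s\<close> is the derivative of \<open>s * U' s - U s - U (1 - s)\<close>.\<close>

lemma U_endpoint_gap: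
  assumes "0 < r" "r < 1" and \<nu>: "\<And>s. 0 < s \<Longrightarrow> s \<le> r \<Longrightarrow> U' (1 - s) + s * U'' s \<le> \<nu>"
  shows "U 0 + U 1 - U r - U (1 - r) \<le> r * (\<nu> - U' r)"
proof -
  \<comment> \<open>\<open>H\<close> is non-increasing on \<open>{0<..r}\<close> because \<nu>
    dominates the derivative of its other terms, and it tends to \<open>- U 0 - U 1\<close> at 0.
    Comparing \<open>H r\<close> with this limit is the claim.\<close>
  define H where "H = (\<lambda>s. s * U' s - U s - U (1 - s) - \<nu> * s)"
  have dH: "(H has_real_derivative U' (1 - s) + s * U'' s - \<nu>) (at s)" if "0 < s" "s < 1" for s
  proof -
    have "((\<lambda>s. U (1 - s)) has_real_derivative U' (1 - s) * (0 - 1)) (at s)"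
      using that by (intro DERIV_chain2[where f=U] U_deriv_interior derivative_intros) auto
    then show ?thesis
      unfolding H_def using that
      by (auto intro!: derivative_eq_intros U_deriv_interior U'_deriv)
  qed
  have H_anti: "H r \<le> H s" if "0 < s" "s < r" for s
  proof (rule DERIV_nonpos_imp_nonincreasing[of s r])
    fix t assume "s \<le> t" "t \<le> r"
    then have t: "0 < t" "t \<le> r" "t < 1" using that assms by auto
    show "\<exists>y. DERIV H t :> y \<and> y \<le> 0"
      using dH[OF t(1,3)] \<nu>[OF t(1,2)] by (intro exI conjI) auto
  qed (use that in auto)
  have "((\<lambda>s. U (1 - s)) \<longlongrightarrow> U (1 - 0)) (at 0 within {0..1})"
  proof -
    have "continuous_on {0..1} (\<lambda>s. U (1 - s))"
      by (rule continuous_on_compose2[OF U_cont]) (auto intro!: continuous_intros)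
    then show ?thesis unfolding continuous_on_def by (rule bspec) simp
  qed
  then have *: "((\<lambda>s. U (1 - s)) \<longlongrightarrow> U 1) (at_right 0)"
    by (simp add: at_within_Icc_at_right)
  have "(H \<longlongrightarrow> 0 - U 0 - U 1 - \<nu> * 0) (at_right 0)"
    unfolding H_def by (intro tendsto_intros U_tendsto_at_0 mult_U'_tendsto_0 *)
  moreover have "\<forall>\<^sub>F s in at_right 0. H r \<le> H s"
    using eventually_at_right_real[OF assms(1)] by eventually_elim (simp add: H_anti)
  ultimately have "H r \<le> 0 - U 0 - U 1 - \<nu> * 0"
    by (rule tendsto_lowerbound) simp
  then show ?thesis by (simp add: H_def algebra_simps)
qed

section \<open>The inverse of \<open>U'\<close>, the threshold \<open>R\<close> and the supremum
  \<nu>\<close>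

text \<open>Makes the \<open>THE\<close> in \<open>eU\<close> denote: \<open>U'\<close> falls below
  \<open>t\<close> near 0, so the intermediate value theorem applies, and injectivity gives
  uniqueness.\<close>

lemma ex1_U'_eq:
  assumes "t \<le> U' 1"
  shows "\<exists>!r. r \<in> {0<..1} \<and> U' r = t"
proof -
  have "\<forall>\<^sub>F s in at_right 0. U' s \<le> t" using U'_lim by (simp add: filterlim_at_bot)
  then have "\<forall>\<^sub>F s in at_right 0. U' s \<le> t \<and> 0 < s \<and> s < 1"
    using eventually_at_right_real[OF zero_less_one] by eventually_elim simp
  then obtain s where s: "U' s \<le> t" "0 < s" "s < 1"
    using eventually_happens'[of "at_right (0::real)"] by fastforce
  have "continuous_on {s..1} U'" by (rule continuous_on_subset[OF U'_cont]) (use s in auto)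
  then obtain r where "s \<le> r" "r \<le> 1" "U' r = t" using IVT'[of U' s t 1] s assms by auto
  moreover have "r' = r" if "r' \<in> {0<..1}" "U' r' = t" for r'
    using U'_le_iff[of r r'] U'_le_iff[of r' r] calculation that s by auto
  ultimately show ?thesis using s by (intro ex1I[of _ r]) auto
qed

lemma eU_props:
  assumes "t \<le> U' 1"
  shows "0 < eU U' t" "eU U' t \<le> 1" "U' (eU U' t) = t"
  using theI'[OF ex1_U'_eq[OF assms]] unfolding eU_def[symmetric] by simp_all

text \<open>The map \<open>R \<mapsto> U' R - U' (1 - R)\<close> vanishes at 1/2, increases
  strictly, and is unbounded as \<open>R\<close> approaches 1 because \<open>U'\<close> tends to
  -\<infinity> at 0.\<close>

lemma ex1_R:
  assumes "0 < D"
  shows "\<exists>!R. 1/2 \<le> R \<and> R < 1 \<and> U' R - U' (1 - R) = D"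
proof -
  have strict: "U' R - U' (1 - R) < U' S - U' (1 - S)" if "1/2 \<le> R" "R < S" "S < 1" for R S
    using U'_strict_mono[of R S] U'_strict_mono[of "1 - S" "1 - R"] that by auto
  \<comment> \<open>With such an \<open>s < 1/2\<close>,
    \<open>U' (1 - s) \<ge> U' (1/2) \<ge> U' s + D\<close>, so the map is at least \<open>D\<close>
    at \<open>1 - s\<close>.\<close>
  have "\<forall>\<^sub>F s in at_right 0. U' s \<le> U' (1/2) - D" using U'_lim by (simp add: filterlim_at_bot)
  then have "\<forall>\<^sub>F s in at_right 0. U' s \<le> U' (1/2) - D \<and> 0 < s \<and> s < 1/2"
    using eventually_at_right_real[of 0 "1/2"] by (auto elim: eventually_elim2)
  then obtain s where s: "U' s \<le> U' (1/2) - D" "0 < s" "s < 1/2"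
    using eventually_happens'[of "at_right (0::real)"] by fastforce
  have "U' (1/2) \<le> U' (1 - s)" using s by (intro U'_mono) auto
  then have "D \<le> U' (1 - s) - U' (1 - (1 - s))" using s by simp
  moreover have "U' (1/2) - U' (1 - 1/2) \<le> D" using assms by simp
  moreover have "continuous_on {1/2..1 - s} (\<lambda>R. U' R - U' (1 - R))"
    using s by (intro continuous_intros continuous_on_subset[OF U'_cont]
        continuous_on_compose2[OF U'_cont]) auto
  ultimately obtain R where R: "1/2 \<le> R" "R \<le> 1 - s" "U' R - U' (1 - R) = D"
    using IVT'[of "\<lambda>R. U' R - U' (1 - R)" "1/2" D "1 - s"] s by auto
  have unique: "R' = R" if "1/2 \<le> R'" "R' < 1" "U' R' - U' (1 - R') = D" for R'
  proof (cases R R' rule: linorder_cases)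
    case less then show ?thesis using strict[of R R'] R that by simp
  next
    case greater then show ?thesis using strict[of R' R] R that s by simp
  qed simp
  show ?thesis
  proof (rule ex1I[of _ R])
    show "1/2 \<le> R \<and> R < 1 \<and> U' R - U' (1 - R) = D" using R s by simp
  qed (use unique in blast)
qed

text \<open>The real supremum is meaningful only on a bounded set. Here \<open>U' (1 - r)\<close> is
  at most \<open>U' 1\<close>, and \<open>r * U'' r\<close> is largest at \<open>R\<close>.\<close>

lemma nu_bdd_above:
  assumes "R < 1"
  shows "bdd_above ((\<lambda>r. U' (1 - r) + r * U'' r) ` {0<..R})"
proof (rule bdd_aboveI2)
  fix r assume "r \<in> {0<..R}"
  then show "U' (1 - r) + r * U'' r \<le> U' 1 + R * U'' R"
    using U'_mono[of "1 - r" 1] mono_onD[OF mono, of r R] assms by (simp add: add_mono)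
qed

text \<open>Drop the positive term \<open>s * U'' s\<close> and let \<open>s\<close> tend to 0. This
  keeps the denominator of the second interval positive.\<close>

lemma nu_ge:
  assumes "0 < R" "R < 1"
  shows "U' 1 \<le> (SUP r\<in>{0<..R}. U' (1 - r) + r * U'' r)" (is "_ \<le> ?\<nu>")
proof -
  \<comment> \<open>Stopping at 1/2 keeps \<open>1 - s\<close> in \<open>{0<..1}\<close>, where
    \<open>U'\<close> is continuous.\<close>
  have "((\<lambda>s. U' (1 - s)) \<longlongrightarrow> U' (1 - 0)) (at 0 within {0..1/2})"
  proof -
    have "continuous_on {0..1/2} (\<lambda>s. U' (1 - s))"
      by (rule continuous_on_compose2[OF U'_cont]) (auto intro!: continuous_intros)
    then show ?thesis unfolding continuous_on_def by (rule bspec) simp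
  qed
  then have "((\<lambda>s. U' (1 - s)) \<longlongrightarrow> U' 1) (at_right 0)"
    by (simp add: at_within_Icc_at_right)
  moreover have "\<forall>\<^sub>F s in at_right 0. U' (1 - s) \<le> ?\<nu>"
    using eventually_at_right_real[OF assms(1)]
  proof eventually_elim
    case (elim s)
    have "U' (1 - s) + s * U'' s \<le> ?\<nu>"
      using nu_bdd_above[OF assms(2)] elim by (intro cSUP_upper) auto
    moreover have "0 < s * U'' s" using U''_pos[of s] elim assms by simp
    ultimately show ?case by linarith
  qed
  ultimately show ?thesis by (rule tendsto_upperbound) simp
qed

end

section \<open>Linear functionals on polytopes and couplings\<close>

lemma INF_ereal_finite:
  assumes "finite S" "S \<noteq> {}"
  shows "(INF v\<in>S. ereal (f v)) = ereal (Min (f ` S))"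
proof (rule antisym)
  have "Min (f ` S) \<in> f ` S" using assms by (intro Min_in) auto
  then obtain v where "v \<in> S" "f v = Min (f ` S)" by (metis imageE)
  then show "(INF v\<in>S. ereal (f v)) \<le> ereal (Min (f ` S))" by (metis INF_lower)
qed (use assms in \<open>auto intro: INF_greatest\<close>)

text \<open>\<open>f\<close> is the inner product with \<open>adjoint f 1\<close>, which turns the
  set into a half-space.\<close>

lemma polyhedron_linear_ge:
  fixes f :: "'a::euclidean_space \<Rightarrow> real"
  assumes "linear f"
  shows "polyhedron {p. c \<le> f p}"
  using polyhedron_halfspace_ge[where a="adjoint f 1" and b=c] adjoint_works[OF assms, of _ 1]
  by (simp add: inner_commute)

lemma polyhedron_linear_eq:
  fixes f :: "'a::euclidean_space \<Rightarrow> real"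
  assumes "linear f"
  shows "polyhedron {p. f p = c}"
  using polyhedron_hyperplane[where a="adjoint f 1" and b=c] adjoint_works[OF assms, of _ 1]
  by (simp add: inner_commute)

text \<open>By Krein-Milman a point is a mixture of an average of optimal vertices
  (\<open>Z\<close>) and an average of the others (\<open>N\<close>). The latter costs at least
  \<open>m + \<Delta>\<close>, so its weight is at most the relative excess cost
  \<open>(f v - m) / \<Delta>\<close>; enlarging the weight to exactly that value only moves part of
  the optimal point into \<open>b\<close>.\<close>

lemma polytope_linear_decomposition:
  fixes S :: "'a::euclidean_space set" and f :: "'a \<Rightarrow> real"
  assumes "polytope S" "linear f" and nonconst: "p \<in> S" "q \<in> S" "f p < f q"
  defines "E \<equiv> {v. v extreme_point_of S}"
  defines "m \<equiv> Min (f ` E)"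
  defines "N \<equiv> {v \<in> E. m < f v}"
  defines "\<Delta> \<equiv> Min (f ` N) - m"
  shows "finite E" "E \<noteq> {}" "N \<noteq> {}" "0 < \<Delta>"
    and "\<And>v. v \<in> S \<Longrightarrow> m \<le> f v"
    and "\<And>v. v \<in> S \<Longrightarrow> f v \<le> m + \<Delta> \<Longrightarrow>
      \<exists>a\<in>S. \<exists>b\<in>S. f a = m \<and> v = (1 - (f v - m) / \<Delta>) *\<^sub>R a + ((f v - m) / \<Delta>) *\<^sub>R b"
proof -
  interpret f: linear f by fact
  show fin: "finite E"
    unfolding E_def using assms(1) by (intro finite_polyhedron_extreme_points polytope_imp_polyhedron)
  have hull: "S = convex hull E"
    unfolding E_def using assms(1)
    by (intro Krein_Milman_Minkowski polytope_imp_compact polytope_imp_convex)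
  then show ne: "E \<noteq> {}" using nonconst by auto
  have "E \<subseteq> S" by (auto simp: E_def extreme_point_of_def)
  have le: "m \<le> f v" if "v \<in> E" for v using that fin by (simp add: m_def)
  define Z where "Z = {v \<in> E. f v = m}"
  have EZN: "E = Z \<union> N" using le by (force simp: Z_def N_def)
  have "m \<in> f ` E" unfolding m_def using fin ne by (intro Min_in) auto
  then have Z: "Z \<noteq> {}" by (auto simp: Z_def)
  have convex_halfspace: "convex {v. c \<le> f v}" "convex {v. f v = c}" for c
    by (intro polyhedron_imp_convex polyhedron_linear_ge polyhedron_linear_eq assms)+
  show le_S: "m \<le> f v" if "v \<in> S" for v
  proof -
    have "convex hull E \<subseteq> {v. m \<le> f v}"
      by (intro hull_minimal convex_halfspace) (use le in auto)
    then show ?thesis using that hull by auto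
  qed
  have hull_Z: "convex hull Z \<subseteq> {v. f v = m}"
    by (intro hull_minimal convex_halfspace) (auto simp: Z_def)
  show N: "N \<noteq> {}"
  proof
    assume "N = {}"
    then have "S = convex hull Z" using hull EZN by simp
    then have "S \<subseteq> {v. f v = m}" using hull_Z by simp
    then have "f p = m" "f q = m" using nonconst(1,2) by blast+
    then show False using nonconst(3) by simp
  qed
  have finN: "finite N" using fin EZN by simp
  then have "Min (f ` N) \<in> f ` N" using N by (intro Min_in) auto
  then show \<Delta>: "0 < \<Delta>" by (auto simp: \<Delta>_def N_def)
  have hull_N: "convex hull N \<subseteq> {v. m + \<Delta> \<le> f v}"
    by (intro hull_minimal convex_halfspace) (use finN in \<open>auto simp: \<Delta>_def\<close>)
  fix v assume v: "v \<in> S" "f v \<le> m + \<Delta>"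
  define r where "r = (f v - m) / \<Delta>"
  have r: "r * \<Delta> = f v - m" using \<Delta> by (simp add: r_def)
  have "v \<in> convex hull (convex hull Z \<union> convex hull N)"
    using v(1) hull EZN hull_mono[of "Z \<union> N" "convex hull Z \<union> convex hull N" convex]
      hull_subset[of Z convex] hull_subset[of N convex] by blast
  then obtain s t u w where st: "v = u *\<^sub>R s + w *\<^sub>R t" "0 \<le> u" "0 \<le> w" "u + w = 1"
      "s \<in> convex hull Z" "t \<in> convex hull N"
    using convex_hull_union_two[of "convex hull Z" "convex hull N"] Z N by auto
  have "s \<in> S" "t \<in> S" using st hull hull_mono[of Z E convex] hull_mono[of N E convex] EZN by auto
  have fs: "f s = m" using st hull_Z by auto
  have ft: "m + \<Delta> \<le> f t" using st hull_N by auto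
  have u: "u = 1 - w" using st by simp
  have "f v = u * f s + w * f t" by (simp add: st(1) f.add f.scale)
  \<comment> \<open>The excess cost of \<open>v\<close> comes from \<open>t\<close> alone, which
    bounds the weight \<open>w\<close>.\<close>
  then have "f v - m = w * (f t - m)" by (simp add: u fs algebra_simps)
  also have "\<dots> \<ge> w * \<Delta>" using ft st by (intro mult_left_mono) auto
  finally have "w * \<Delta> \<le> r * \<Delta>" using r by simp
  then have "w \<le> r" using \<Delta> by simp
  \<comment> \<open>Chosen so that \<open>t\<close> gets total weight
    \<open>r * (w / r) = w\<close>. For \<open>r = 0\<close> also \<open>w = 0\<close>, and division
    by zero yields 0, so \<open>b = s\<close>.\<close>
  define b where "b = (1 - w / r) *\<^sub>R s + (w / r) *\<^sub>R t"
  have "w / r \<le> 1" "0 \<le> w / r" using \<open>w \<le> r\<close> st by (auto simp: divide_le_eq_1)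
  then have "b \<in> S"
    unfolding b_def using \<open>s \<in> S\<close> \<open>t \<in> S\<close> polytope_imp_convex[OF assms(1)]
    by (intro convexD_alt[of S s t]) auto
  moreover have "v = (1 - r) *\<^sub>R s + r *\<^sub>R b"
  proof (cases "r = 0")
    case True
    then have "w = 0" using \<open>w \<le> r\<close> st by simp
    then show ?thesis using st True by (simp add: u)
  next
    case False
    then show ?thesis by (simp add: b_def st(1) u algebra_simps)
  qed
  ultimately show "\<exists>a\<in>S. \<exists>b\<in>S. f a = m \<and> v = (1 - (f v - m) / \<Delta>) *\<^sub>R a + ((f v - m) / \<Delta>) *\<^sub>R b"
    using \<open>s \<in> S\<close> fs unfolding r_def by blast
qed

section \<open>Couplings as a polytope and the vertex gap\<close>

lemma linear_entry_sums:
  shows "linear (\<lambda>P :: real ^ 'j::finite ^ 'i::finite. P $ i $ j)"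
    and "linear (\<lambda>P :: real ^ 'j::finite ^ 'i::finite. \<Sum>j\<in>UNIV. P $ i $ j)"
    and "linear (\<lambda>P :: real ^ 'j::finite ^ 'i::finite. \<Sum>i\<in>UNIV. P $ i $ j)"
    and "linear (\<lambda>P :: real ^ 'j::finite ^ 'i::finite. \<Sum>i\<in>UNIV. \<Sum>j\<in>UNIV. P $ i $ j)"
    and "linear (pairing (C :: real ^ 'j::finite ^ 'i::finite))"
  by (auto intro!: linearI simp: pairing_def sum.distrib sum_distrib_left algebra_simps)

lemma couplings_entry:
  assumes "P \<in> couplings x y"
  shows "0 \<le> P $ i $ j" "P $ i $ j \<le> x $ i" "P $ i $ j \<le> y $ j" "P $ i $ j \<le> 1"
proof -
  have nonneg: "0 \<le> P $ i $ j" for i j using assms by (simp add: couplings_def)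
  then show "0 \<le> P $ i $ j" .
  have x: "x $ i = (\<Sum>j\<in>UNIV. P $ i $ j)" for i using assms by (simp add: couplings_def)
  show xi: "P $ i $ j \<le> x $ i" unfolding x using nonneg by (intro member_le_sum) auto
  have "y $ j = (\<Sum>i\<in>UNIV. P $ i $ j)" using assms by (simp add: couplings_def)
  then show "P $ i $ j \<le> y $ j"
    using member_le_sum[of i UNIV "\<lambda>i. P $ i $ j"] nonneg by simp
  have "x $ i \<le> (\<Sum>i\<in>UNIV. x $ i)"
    using nonneg by (intro member_le_sum) (auto simp: x intro: sum_nonneg)
  also have "\<dots> = (\<Sum>i\<in>UNIV. \<Sum>j\<in>UNIV. P $ i $ j)" by (simp only: x)
  also have "\<dots> = 1" using assms unfolding couplings_def by blast
  finally show "P $ i $ j \<le> 1" using xi by simp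
qed

text \<open>A zero product entry has a zero marginal in its row or column, which forces the entry of
  \<open>P\<close> to vanish. Hence the divergence of a coupling is finite.\<close>

lemma tensor_entry:
  assumes "x \<in> prob_simplex" "y \<in> prob_simplex" "P \<in> couplings x y"
  shows "0 < tensor x y $ i $ j \<and> tensor x y $ i $ j \<le> 1
    \<or> tensor x y $ i $ j = 0 \<and> P $ i $ j = 0"
proof -
  have nonneg: "0 \<le> x $ i \<and> 0 \<le> y $ j" for i j using assms by (auto simp: prob_simplex_def)
  have "x $ i \<le> (\<Sum>i\<in>UNIV. x $ i)" "y $ j \<le> (\<Sum>j\<in>UNIV. y $ j)"
    using nonneg by (auto intro!: member_le_sum)
  then have "x $ i \<le> 1" "y $ j \<le> 1" using assms by (auto simp: prob_simplex_def)
  then have "x $ i * y $ j \<le> 1" using nonneg by (simp add: mult_le_one)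
  then show ?thesis
    using nonneg[of i j] couplings_entry(1-3)[OF assms(3), of i j] by (auto simp: tensor_def less_le)
qed

lemma polytope_couplings: "polytope (couplings x y)"
proof -
  have "couplings x y = (\<Inter>i. \<Inter>j. {P. 0 \<le> P $ i $ j})
      \<inter> {P. (\<Sum>i\<in>UNIV. \<Sum>j\<in>UNIV. P $ i $ j) = 1}
      \<inter> (\<Inter>i. {P. (\<Sum>j\<in>UNIV. P $ i $ j) = x $ i})
      \<inter> (\<Inter>j. {P. (\<Sum>i\<in>UNIV. P $ i $ j) = y $ j})"
    by (auto simp: couplings_def)
  moreover have "polyhedron \<dots>"
    by (intro polyhedron_Int polyhedron_Inter)
      (auto intro!: polyhedron_Inter polyhedron_linear_ge polyhedron_linear_eq linear_entry_sums)
  ultimately have "polyhedron (couplings x y)" by simp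
  moreover have "bounded (couplings x y)"
  proof (rule boundedI)
    fix P assume P: "P \<in> couplings x y"
    have "norm P \<le> (\<Sum>i\<in>UNIV. norm (P $ i))" by (simp add: norm_vec_def L2_set_le_sum)
    also have "\<dots> \<le> (\<Sum>i\<in>UNIV. \<Sum>j\<in>UNIV. \<bar>P $ i $ j\<bar>)"
      by (intro sum_mono norm_le_l1_cart)
    also have "\<dots> = (\<Sum>i\<in>UNIV. \<Sum>j\<in>UNIV. P $ i $ j)" using couplings_entry(1)[OF P] by simp
    also have "\<dots> = 1" using P unfolding couplings_def by blast
    finally show "norm P \<le> 1" .
  qed
  ultimately show ?thesis by (simp add: polytope_eq_bounded_polyhedron)
qed

text \<open>Assumption (i) says that the cost is not constant on the couplings, so non-optimal
  vertices exist and the gap is a finite positive number. All infima are attained at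
  vertices.\<close>

lemma DeltaC_gap:
  assumes nonoptimal: "couplings x y \<noteq> {P \<in> couplings x y. \<forall>Q \<in> couplings x y. pairing C P \<le> pairing C Q}"
  obtains m \<Delta> where "DeltaC C x y = ereal \<Delta>" "0 < \<Delta>"
    and "(INF P\<in>couplings x y. pairing C P) = m"
    and "\<And>P. P \<in> couplings x y \<Longrightarrow> m \<le> pairing C P"
    and "\<And>P. P \<in> couplings x y \<Longrightarrow> pairing C P \<le> m + \<Delta> \<Longrightarrow>
      \<exists>A\<in>couplings x y. \<exists>B\<in>couplings x y. pairing C A = m \<and>
        P = (1 - (pairing C P - m) / \<Delta>) *\<^sub>R A + ((pairing C P - m) / \<Delta>) *\<^sub>R B"
    and "\<exists>A\<in>couplings x y. pairing C A = m"
proof -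
  let ?S = "couplings x y" and ?f = "pairing C"
  obtain P Q where PQ: "P \<in> ?S" "Q \<in> ?S" "?f P < ?f Q" using nonoptimal by force
  define E where "E = {v. v extreme_point_of ?S}"
  define m where "m = Min (?f ` E)"
  define N where "N = {v \<in> E. m < ?f v}"
  define \<Delta> where "\<Delta> = Min (?f ` N) - m"
  note dec = polytope_linear_decomposition[OF polytope_couplings linear_entry_sums(5) PQ,
      folded E_def, folded m_def, folded N_def, folded \<Delta>_def]
  have "m \<in> ?f ` E" unfolding m_def using dec by (intro Min_in) auto
  then obtain V where V: "V \<in> E" "?f V = m" by auto
  then have "V \<in> ?S" by (simp add: E_def extreme_point_of_def)
  have "vertices x y = E" by (auto simp: vertices_def E_def)
  moreover have "E - {V \<in> E. \<forall>W\<in>E. ?f V \<le> ?f W} = N"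
  proof -
    \<comment> \<open>Since \<open>V\<close> attains \<open>m\<close>, a vertex fails to be optimal
      exactly when it costs more than \<open>m\<close>.\<close>
    have "(\<forall>W\<in>E. ?f v \<le> ?f W) \<longleftrightarrow> \<not> m < ?f v" if "v \<in> E" for v
      using dec(1) V by (auto simp: not_less m_def intro: order_trans Min_le)
    then show ?thesis by (auto simp: N_def)
  qed
  moreover have "finite N" using dec(1) by (simp add: N_def)
  ultimately have "DeltaC C x y = ereal \<Delta>"
    using dec by (simp add: DeltaC_def Let_def INF_ereal_finite \<Delta>_def m_def)
  moreover have "(INF P\<in>?S. ?f P) = m"
    using \<open>V \<in> ?S\<close> V dec(5) by (intro antisym cINF_greatest cINF_lower2 bdd_belowI2) auto
  ultimately show ?thesis
    using that dec \<open>V \<in> ?S\<close> V by blast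
qed

section \<open>The divergence on couplings\<close>

context bregman_generator
begin

text \<open>Real-valued counterpart of \<open>DU\<close>. Where an entry of \<open>W\<close> and
  that of \<open>P\<close> are both 0, the arbitrary value \<open>U' 0\<close> is multiplied by 0,
  so the term is 0 as in \<open>dU_0_0\<close>.\<close>

definition divergence :: "real ^ 'j::finite ^ 'i::finite \<Rightarrow> real ^ 'j ^ 'i \<Rightarrow> real" where
  "divergence P W = (\<Sum>i\<in>UNIV. \<Sum>j\<in>UNIV.
     U (P $ i $ j) - U (W $ i $ j) - (P $ i $ j - W $ i $ j) * U' (W $ i $ j))"

lemma divergence_term:
  assumes "x \<in> prob_simplex" "y \<in> prob_simplex" "P \<in> couplings x y"
  defines "p \<equiv> \<lambda>i j. P $ i $ j" and "w \<equiv> \<lambda>i j. tensor x y $ i $ j"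
  shows "dU U U' (p i j) (w i j) = ereal (U (p i j) - U (w i j) - (p i j - w i j) * U' (w i j))"
    and "0 \<le> U (p i j) - U (w i j) - (p i j - w i j) * U' (w i j)"
    and "p i j \<noteq> w i j \<Longrightarrow> 0 < U (p i j) - U (w i j) - (p i j - w i j) * U' (w i j)"
  using tensor_entry[OF assms(1-3), of i j] couplings_entry(1,4)[OF assms(3), of i j]
    U_tangent[of "w i j" "p i j"] U_tangent_strict[of "w i j" "p i j"]
  by (auto simp: p_def w_def dU_pos dU_0_0 zero_ereal_def)

lemma DU_eq_divergence:
  assumes "x \<in> prob_simplex" "y \<in> prob_simplex" "P \<in> couplings x y"
  shows "DU U U' P (tensor x y) = ereal (divergence P (tensor x y))"
  unfolding DU_def divergence_def by (simp add: divergence_term(1)[OF assms])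

lemma divergence_nonneg:
  assumes "x \<in> prob_simplex" "y \<in> prob_simplex" "P \<in> couplings x y"
  shows "0 \<le> divergence P (tensor x y)"
  unfolding divergence_def by (intro sum_nonneg divergence_term(2)[OF assms])

lemma divergence_pos:
  assumes "x \<in> prob_simplex" "y \<in> prob_simplex" "P \<in> couplings x y" "P \<noteq> tensor x y"
  shows "0 < divergence P (tensor x y)"
proof -
  obtain i j where "P $ i $ j \<noteq> tensor x y $ i $ j" using assms(4) by (auto simp: vec_eq_iff)
  then show ?thesis
    unfolding divergence_def using divergence_term(2,3)[OF assms(1-3)]
    by (intro sum_pos2[of _ i] sum_pos2[of _ j] sum_nonneg) auto
qed

text \<open>With \<open>W\<close> fixed, each term is \<open>U\<close> of an entry plus an affine
  function of it; \<open>U'\<close> is never taken at a varying point.\<close>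

lemma continuous_on_divergence: "continuous_on (couplings x y) (\<lambda>P. divergence P W)"
  unfolding divergence_def
  by (intro continuous_intros continuous_on_compose2[OF U_cont])
    (auto simp: couplings_entry)

text \<open>The parts affine in the first argument cancel, so \<open>W\<close> disappears and the
  entrywise bound \<open>U_jensen_gap\<close> applies. Both couplings have total mass 1, which
  leaves \<open>c + d\<close>.\<close>

lemma divergence_jensen_gap:
  assumes "A \<in> couplings x y" "B \<in> couplings x y" "0 \<le> r" "r \<le> 1"
  shows "(1 - r) * divergence A W + r * divergence B W - divergence ((1 - r) *\<^sub>R A + r *\<^sub>R B) W
    \<le> U 0 + U 1 - U r - U (1 - r)"
proof -
  define c where "c = (1 - r) * U 1 + r * U 0 - U (1 - r)"
  define d where "d = r * U 1 + (1 - r) * U 0 - U r"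
  have "(1 - r) * divergence A W + r * divergence B W - divergence ((1 - r) *\<^sub>R A + r *\<^sub>R B) W
     = (\<Sum>i\<in>UNIV. \<Sum>j\<in>UNIV. (1 - r) * U (A $ i $ j) + r * U (B $ i $ j)
          - U ((1 - r) * A $ i $ j + r * B $ i $ j))"
    unfolding divergence_def sum_distrib_left sum.distrib[symmetric] sum_subtractf[symmetric]
    by (intro sum.cong refl) (simp add: algebra_simps)
  also have "\<dots> \<le> (\<Sum>i\<in>UNIV. \<Sum>j\<in>UNIV. A $ i $ j * c + B $ i $ j * d)"
    unfolding c_def d_def using assms
    by (intro sum_mono U_jensen_gap) (auto simp: couplings_entry)
  also have "\<dots> = (\<Sum>i\<in>UNIV. \<Sum>j\<in>UNIV. A $ i $ j) * c + (\<Sum>i\<in>UNIV. \<Sum>j\<in>UNIV. B $ i $ j) * d"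
    by (simp add: sum.distrib sum_distrib_right)
  also have "(\<Sum>i\<in>UNIV. \<Sum>j\<in>UNIV. A $ i $ j) = 1" using assms(1) unfolding couplings_def by blast
  also have "(\<Sum>i\<in>UNIV. \<Sum>j\<in>UNIV. B $ i $ j) = 1" using assms(2) unfolding couplings_def by blast
  also have "1 * c + 1 * d = U 0 + U 1 - U r - U (1 - r)" by (simp add: c_def d_def algebra_simps)
  finally show ?thesis .
qed

text \<open>Distinct couplings differ in some entry, where the midpoint inequality for
  \<open>U\<close> is strict.\<close>

lemma divergence_midpoint:
  assumes "P \<in> couplings x y" "Q \<in> couplings x y" "P \<noteq> Q"
  shows "divergence ((1/2) *\<^sub>R P + (1/2) *\<^sub>R Q) W < (divergence P W + divergence Q W) / 2"
proof -
  let ?g = "\<lambda>i j. (U (P $ i $ j) + U (Q $ i $ j)) / 2 - U (P $ i $ j / 2 + Q $ i $ j / 2)"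
  have "0 \<le> ?g i j" "P $ i $ j \<noteq> Q $ i $ j \<Longrightarrow> 0 < ?g i j" for i j
    using U_convex[of "P $ i $ j" "Q $ i $ j" "1/2"] U_strict_convex[of "P $ i $ j" "Q $ i $ j" "1/2"]
      couplings_entry(1,4)[OF assms(1)] couplings_entry(1,4)[OF assms(2)]
    by (auto simp: field_simps)
  moreover obtain i j where "P $ i $ j \<noteq> Q $ i $ j" using assms(3) by (auto simp: vec_eq_iff)
  ultimately have "0 < (\<Sum>i\<in>UNIV. \<Sum>j\<in>UNIV. ?g i j)"
    by (intro sum_pos2[of _ i] sum_pos2[of _ j] sum_nonneg) auto
  also have "\<dots> = (1/2) * divergence P W + (1/2) * divergence Q W
      - divergence ((1/2) *\<^sub>R P + (1/2) *\<^sub>R Q) W"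
    unfolding divergence_def sum_distrib_left sum.distrib[symmetric] sum_subtractf[symmetric]
    by (intro sum.cong refl) (simp add: field_simps)
  finally show ?thesis by simp
qed

section \<open>The regularized minimizer and the maximal divergence\<close>

text \<open>Makes the \<open>THE\<close> in \<open>PiU\<close> denote: compactness gives a
  minimizer, and the midpoint of two distinct ones would have a smaller objective.\<close>

lemma PiU_minimizer:
  fixes C :: "real ^ 'j::finite ^ 'i::finite"
  assumes xy: "x \<in> prob_simplex" "y \<in> prob_simplex" and ne: "couplings x y \<noteq> {}" and "0 < \<epsilon>"
  shows "PiU U U' C x y \<epsilon> \<in> couplings x y"
    and "Q \<in> couplings x y \<Longrightarrow>
      pairing C (PiU U U' C x y \<epsilon>) + \<epsilon> * divergence (PiU U U' C x y \<epsilon>) (tensor x y)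
        \<le> pairing C Q + \<epsilon> * divergence Q (tensor x y)"
proof -
  let ?S = "couplings x y"
  define g where "g P = pairing C P + \<epsilon> * divergence P (tensor x y)" for P
  have eq: "ereal (pairing C P) + ereal \<epsilon> * DU U U' P (tensor x y) = ereal (g P)" if "P \<in> ?S" for P
    by (simp add: DU_eq_divergence[OF xy that] g_def)
  have "continuous_on ?S g"
    unfolding g_def
    by (intro continuous_intros continuous_on_divergence linear_continuous_on
        linear_conv_bounded_linear[THEN iffD1] linear_entry_sums)
  then obtain P where P: "P \<in> ?S" "\<forall>Q\<in>?S. g P \<le> g Q"
    using continuous_attains_inf[OF polytope_imp_compact[OF polytope_couplings] ne] by blast
  have unique: "P' = P" if P': "P' \<in> ?S" "\<forall>Q\<in>?S. g P' \<le> g Q" for P'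
  proof (rule ccontr)
    interpret linear "pairing C" by (rule linear_entry_sums)
    let ?M = "(1/2) *\<^sub>R P' + (1/2) *\<^sub>R P"
    assume "P' \<noteq> P"
    then have "\<epsilon> * divergence ?M (tensor x y)
        < \<epsilon> * ((divergence P' (tensor x y) + divergence P (tensor x y)) / 2)"
      using divergence_midpoint[OF P'(1) P(1)] \<open>0 < \<epsilon>\<close> by simp
    moreover have "pairing C ?M = (pairing C P' + pairing C P) / 2"
      by (simp add: add scale)
    ultimately have "g ?M < (g P' + g P) / 2" by (simp add: g_def algebra_simps)
    also have "\<dots> = g P" using P P' by (auto intro: antisym)
    finally have "g ?M < g P" .
    moreover have "?M \<in> ?S"
      using polytope_imp_convex[OF polytope_couplings] P P' by (intro convexD) auto
    ultimately show False using P by fastforce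
  qed
  have "P \<in> ?S \<and> (\<forall>Q\<in>?S. ereal (pairing C P) + ereal \<epsilon> * DU U U' P (tensor x y)
      \<le> ereal (pairing C Q) + ereal \<epsilon> * DU U U' Q (tensor x y))
    \<longleftrightarrow> P \<in> ?S \<and> (\<forall>Q\<in>?S. g P \<le> g Q)" for P
    by (simp add: eq cong: conj_cong)
  then have PiU_eq: "PiU U U' C x y \<epsilon> = (THE P. P \<in> ?S \<and> (\<forall>Q\<in>?S. g P \<le> g Q))"
    by (simp only: PiU_def)
  have "\<exists>!P. P \<in> ?S \<and> (\<forall>Q\<in>?S. g P \<le> g Q)" using P unique by blast
  then have "PiU U U' C x y \<epsilon> \<in> ?S \<and> (\<forall>Q\<in>?S. g (PiU U U' C x y \<epsilon>) \<le> g Q)"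
    unfolding PiU_eq by (rule theI')
  then show "PiU U U' C x y \<epsilon> \<in> ?S"
    and "Q \<in> ?S \<Longrightarrow> pairing C (PiU U U' C x y \<epsilon>)
        + \<epsilon> * divergence (PiU U U' C x y \<epsilon>) (tensor x y)
      \<le> pairing C Q + \<epsilon> * divergence Q (tensor x y)"
    unfolding g_def by blast+
qed

text \<open>The supremum is attained by compactness. Two distinct couplings cannot both equal
  \<open>tensor x y\<close>, and any other coupling has positive divergence.\<close>

lemma frakD_eq:
  assumes xy: "x \<in> prob_simplex" "y \<in> prob_simplex"
    and PQ: "P \<in> couplings x y" "Q \<in> couplings x y" "P \<noteq> Q"
  obtains D where "frakD U U' x y = ereal D" "0 < D"
    and "\<And>A. A \<in> couplings x y \<Longrightarrow> divergence A (tensor x y) \<le> D"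
proof -
  let ?S = "couplings x y"
  obtain M where M: "M \<in> ?S" "\<forall>A\<in>?S. divergence A (tensor x y) \<le> divergence M (tensor x y)"
    using continuous_attains_sup[OF polytope_imp_compact[OF polytope_couplings] _
        continuous_on_divergence] PQ by blast
  have "frakD U U' x y = ereal (divergence M (tensor x y))"
    unfolding frakD_def
  proof (rule SUP_eqI)
    fix A assume "A \<in> ?S"
    then show "DU U U' A (tensor x y) \<le> ereal (divergence M (tensor x y))"
      using M by (simp add: DU_eq_divergence[OF xy])
  next
    fix z assume "\<And>A. A \<in> ?S \<Longrightarrow> DU U U' A (tensor x y) \<le> z"
    then show "ereal (divergence M (tensor x y)) \<le> z"
      using M by (metis DU_eq_divergence[OF xy])
  qed
  moreover have "P \<noteq> tensor x y \<or> Q \<noteq> tensor x y" using PQ by auto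
  then have "0 < divergence M (tensor x y)"
    using divergence_pos[OF xy] PQ M by (meson less_le_trans)
  ultimately show ?thesis using that M by blast
qed

end

section \<open>The suboptimality bound\<close>

theorem theorem1p7:
  fixes C :: "real ^ 'j::finite ^ 'i::finite"
    and x :: "real ^ 'i" and y :: "real ^ 'j"
    and U U' U'' :: "real \<Rightarrow> real"
  assumes x: "x \<in> prob_simplex" and y: "y \<in> prob_simplex"
    and i: "couplings x y \<noteq> {P \<in> couplings x y. \<forall>Q \<in> couplings x y. pairing C P \<le> pairing C Q}"
    and U_cont: "continuous_on {0..1} U"
    and U_deriv: "\<And>r. r \<in> {0<..1} \<Longrightarrow> (U has_real_derivative U' r) (at r within {0..1})"
    and U'_cont: "continuous_on {0<..1} U'"
    and U'_deriv: "\<And>r. r \<in> {0<..<1} \<Longrightarrow> (U' has_real_derivative U'' r) (at r)"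
    and U''_cont: "continuous_on {0<..<1} U''"
    and U''_pos: "\<And>r. r \<in> {0<..<1} \<Longrightarrow> 0 < U'' r"
    and U'_lim: "filterlim U' at_bot (at_right 0)"
    and mono: "mono_on {0<..<1} (\<lambda>r. r * U'' r)"
  shows "\<exists>\<Delta> D. DeltaC C x y = ereal \<Delta> \<and> frakD U U' x y = ereal D \<and> 0 < \<Delta> \<and> 0 < D
     \<and> (\<exists>!R. 1/2 \<le> R \<and> R < 1 \<and> ereal (U' R - U' (1 - R)) = frakD U U' x y)
     \<and> 0 < D + nuU U U' U'' x y - U' 1
     \<and> {0<..\<Delta> * RU U U' x y / D} \<inter> {0<..\<Delta> / (D + nuU U U' U'' x y - U' 1)} \<noteq> {}
     \<and> (\<forall>\<epsilon> \<in> {0<..\<Delta> * RU U U' x y / D} \<inter> {0<..\<Delta> / (D + nuU U U' U'' x y - U' 1)}.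
          pairing C (PiU U U' C x y \<epsilon>) - (INF P\<in>couplings x y. pairing C P)
            \<le> \<Delta> * eU U' (- \<Delta> / \<epsilon> + D + nuU U U' U'' x y))"
proof -
  interpret bregman_generator U U' U''
    by unfold_locales (fact assms)+
  let ?S = "couplings x y" and ?W = "tensor x y"
  obtain m \<Delta> where \<Delta>: "DeltaC C x y = ereal \<Delta>" "0 < \<Delta>"
    and inf: "(INF P\<in>?S. pairing C P) = m" "\<And>P. P \<in> ?S \<Longrightarrow> m \<le> pairing C P"
    and dec: "\<And>P. P \<in> ?S \<Longrightarrow> pairing C P \<le> m + \<Delta> \<Longrightarrow>
      \<exists>A\<in>?S. \<exists>B\<in>?S. pairing C A = m \<and>
        P = (1 - (pairing C P - m) / \<Delta>) *\<^sub>R A + ((pairing C P - m) / \<Delta>) *\<^sub>R B"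
    and opt: "\<exists>A\<in>?S. pairing C A = m"
    by (rule DeltaC_gap[OF i]) (rule that)
  obtain P Q where "P \<in> ?S" "Q \<in> ?S" "P \<noteq> Q" using i by fastforce
  then obtain D where D: "frakD U U' x y = ereal D" "0 < D"
    and D_ge: "\<And>A. A \<in> ?S \<Longrightarrow> divergence A ?W \<le> D"
    by (rule frakD_eq[OF x y]) (rule that)
  define R where "R = RU U U' x y"
  define \<nu> where "\<nu> = nuU U U' U'' x y"
  have ex1: "\<exists>!R. 1/2 \<le> R \<and> R < 1 \<and> ereal (U' R - U' (1 - R)) = frakD U U' x y"
    using ex1_R[OF D(2)] by (simp add: D)
  have R: "1/2 \<le> R" "R < 1"
    using theI'[OF ex1, folded RU_def] by (auto simp: R_def)
  have \<nu>_eq: "\<nu> = (SUP r\<in>{0<..R}. U' (1 - r) + r * U'' r)"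
    by (simp add: \<nu>_def nuU_def R_def)
  have \<nu>_upper: "U' (1 - s) + s * U'' s \<le> \<nu>" if "0 < s" "s \<le> R" for s
    unfolding \<nu>_eq using nu_bdd_above[OF R(2)] that by (intro cSUP_upper) auto
  have "U' 1 \<le> \<nu>" unfolding \<nu>_eq using R by (intro nu_ge) auto
  then have pos: "0 < D + \<nu> - U' 1" using D by simp
  have "min (\<Delta> * R / D) (\<Delta> / (D + \<nu> - U' 1)) \<in> {0<..\<Delta> * R / D} \<inter> {0<..\<Delta> / (D + \<nu> - U' 1)}"
    using \<Delta> R D pos by simp
  then have ne: "{0<..\<Delta> * R / D} \<inter> {0<..\<Delta> / (D + \<nu> - U' 1)} \<noteq> {}" by blast
  have bound: "pairing C (PiU U U' C x y \<epsilon>) - (INF P\<in>?S. pairing C P) \<le> \<Delta> * eU U' (- \<Delta> / \<epsilon> + D + \<nu>)"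
    if \<epsilon>: "\<epsilon> \<in> {0<..\<Delta> * R / D} \<inter> {0<..\<Delta> / (D + \<nu> - U' 1)}" for \<epsilon>
  proof -
    have \<epsilon>0: "0 < \<epsilon>" and \<epsilon>1: "\<epsilon> * D \<le> \<Delta> * R" and \<epsilon>2: "\<epsilon> * (D + \<nu> - U' 1) \<le> \<Delta>"
      using \<epsilon> D pos by (auto simp: pos_le_divide_eq)
    define P where "P = PiU U U' C x y \<epsilon>"
    define r where "r = (pairing C P - m) / \<Delta>"
    define e where "e = eU U' (- \<Delta> / \<epsilon> + D + \<nu>)"
    \<comment> \<open>The second interval is exactly what keeps the argument of \<open>eU\<close> at
      most \<open>U' 1\<close>, inside the range of \<open>U'\<close>.\<close>
    have "D + \<nu> - U' 1 \<le> \<Delta> / \<epsilon>" using \<epsilon>0 \<epsilon>2 by (simp add: pos_le_divide_eq mult.commute)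
    then have "- \<Delta> / \<epsilon> + D + \<nu> \<le> U' 1" by simp
    note e = eU_props[OF this, folded e_def]
    have "?S \<noteq> {}" using opt by auto
    note minimizer = PiU_minimizer[OF x y this \<epsilon>0, where C=C, folded P_def]
    have gap: "pairing C P - m = r * \<Delta>" using \<Delta> by (simp add: r_def)
    \<comment> \<open>Minimality of \<open>P\<close> against an optimal coupling \<open>A\<close>:
      the excess cost is paid for by the drop in divergence.\<close>
    have opt_le: "r * \<Delta> \<le> \<epsilon> * (divergence A ?W - divergence P ?W)" if "A \<in> ?S" "pairing C A = m" for A
      using minimizer(2)[OF that(1)] unfolding gap[symmetric] that(2) right_diff_distrib by linarith
    have "0 \<le> r" using inf(2)[OF minimizer(1)] \<Delta> by (simp add: r_def)
    obtain A0 where A0: "A0 \<in> ?S" "pairing C A0 = m" using opt by auto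
    \<comment> \<open>A crude first bound: the drop is at most \<open>D\<close>, so the first
      interval yields \<open>r \<le> R\<close>. This brings \<open>r\<close> into the range over
      which \<nu> is the supremum, and below 1.\<close>
    have "r * \<Delta> \<le> \<epsilon> * (divergence A0 ?W - divergence P ?W)" by (rule opt_le[OF A0])
    also have "\<dots> \<le> \<epsilon> * D"
      using D_ge[OF A0(1)] divergence_nonneg[OF x y minimizer(1)] \<epsilon>0 by (intro mult_left_mono) auto
    also have "\<dots> \<le> R * \<Delta>" using \<epsilon>1 by (simp add: mult.commute)
    finally have "r \<le> R" using \<Delta> by simp
    then have "r < 1" using R by simp
    have "r \<le> e"
    \<comment> \<open>The main case divides by \<open>r\<close> and evaluates \<open>U'\<close> at
      \<open>r\<close>, so it needs \<open>r > 0\<close>.\<close>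
    proof (cases "r = 0")
      case True
      then show ?thesis using e by simp
    next
      case False
      then have "0 < r" using \<open>0 \<le> r\<close> by simp
      have "r * \<Delta> \<le> \<Delta>" using \<open>r < 1\<close> \<Delta> by simp
      then have "pairing C P \<le> m + \<Delta>" using gap by simp
      then obtain A B where AB: "A \<in> ?S" "B \<in> ?S" "pairing C A = m" "P = (1 - r) *\<^sub>R A + r *\<^sub>R B"
        using dec[OF minimizer(1)] unfolding r_def by blast
      \<comment> \<open>The Jensen gap of the divergence, with
        \<open>(1 - r) * divergence A ?W\<close> split to isolate the drop from \<open>A\<close> to
        \<open>P\<close>.\<close>
      have "divergence A ?W - divergence P ?W
          \<le> r * (divergence A ?W - divergence B ?W) + (U 0 + U 1 - U r - U (1 - r))"
        using divergence_jensen_gap[OF AB(1,2) \<open>0 \<le> r\<close>, of ?W] \<open>r < 1\<close>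
        by (simp add: AB(4) algebra_simps)
      also have "\<dots> \<le> r * D + r * (\<nu> - U' r)"
      proof (intro add_mono mult_left_mono)
        show "divergence A ?W - divergence B ?W \<le> D"
          using D_ge[OF AB(1)] divergence_nonneg[OF x y AB(2)] by simp
        show "U 0 + U 1 - U r - U (1 - r) \<le> r * (\<nu> - U' r)"
          using \<open>0 < r\<close> \<open>r < 1\<close> \<open>r \<le> R\<close> by (intro U_endpoint_gap \<nu>_upper) auto
      qed (fact \<open>0 \<le> r\<close>)
      finally have "divergence A ?W - divergence P ?W \<le> r * (D + \<nu> - U' r)"
        by (simp add: algebra_simps)
      then have "\<epsilon> * (divergence A ?W - divergence P ?W) \<le> \<epsilon> * (r * (D + \<nu> - U' r))"
        using \<epsilon>0 by (intro mult_left_mono) auto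
      then have "r * \<Delta> \<le> r * (\<epsilon> * (D + \<nu> - U' r))"
        using opt_le[OF AB(1,3)] by (simp add: algebra_simps)
      \<comment> \<open>Cancelling \<open>r\<close> turns minimality into an upper bound on
        \<open>U' r\<close>, which equals \<open>U' e\<close> at the extreme.\<close>
      then have "\<Delta> \<le> (D + \<nu> - U' r) * \<epsilon>" using \<open>0 < r\<close> by (simp add: mult.commute)
      then have "\<Delta> / \<epsilon> \<le> D + \<nu> - U' r" using \<epsilon>0 by (simp add: pos_divide_le_eq)
      then have "U' r \<le> U' e" using e by simp
      then show ?thesis using U'_le_iff[of r e] \<open>0 < r\<close> \<open>r < 1\<close> e by simp
    qed
    then have "r * \<Delta> \<le> \<Delta> * e" using \<Delta> by (simp add: mult.commute)
    then show ?thesis using gap inf by (simp add: P_def e_def)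
  qed
  show ?thesis
    using \<Delta> D ex1 pos ne bound unfolding R_def \<nu>_def by blast
qed

end
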